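(* Let $1<p,q<\infty$ with $\frac1p+\frac1q=1$, let $\Gamma$ be a rooted tree with root $a$, $\Gamma^*=\Gamma\setminus\{a\}$, and let $\bm u=\{u_t\}_{t\in\Gamma^*}$ and $\bm v=\{v_t\}_{t\in\Gamma^*}$ be two positive weights. Suppose that for some $\theta>1$ $$A_{tree}:=\sup_{t\in\Gamma^*}\left(\sum_{a\prec s\preceq t} u_s^{-q}\right)^{\frac{1}{\theta q}}\left(\sum_{s\succeq t}v_s^p \Big(\sum_{a\prec r\preceq s}u_r^{-q}\Big)^{\frac{p}{q}\left(1-\frac{1}{\theta}\right)}\right)^{\frac{1}{p}}<\infty .$$ Then there is a constant $C$ such that $$\left(\sum_{s\in\Gamma^*} \Big|v_s\sum_{a\prec t\preceq s} d_t\Big|^p\right)^{\frac{1}{p}} \le C \left(\sum_{s\in\Gamma^*} |d_s u_s|^p\right)^{\frac{1}{p}}$$ for every real collection $\{d_t\}_{t\in\Gamma^*}$ with $\sum_{t\in\Gamma^*}|d_tu_t|^p<\infty$. In addition, the optimal constant $C$ in this inequality satisfies $$C\le \Big(\frac{\theta}{\theta-1}\Big)^{\frac1q}A_{tree}.$$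
   Context: A rooted tree $\Gamma$ is (the vertex set of) a connected graph without cycles with one vertex $a$ designated as the root; every vertex is assumed to have finitely many children ($\Gamma$ may be infinite). The partial order $\preceq$ on $\Gamma$ is: $s\preceq t$ if and only if the unique path connecting $t$ to $a$ passes through $s$; $s\prec t$ means $s\preceq t$ and $s\ne t$. Sums such as $\sum_{s\succeq t}$ run over all vertices $s\in\Gamma^*$ with $s\succeq t$. *)

theory Defs
  imports "HOL-Analysis.Analysis"
begin

text \<open>
  Undirected simple graphs are given by a vertex set \<open>V\<close> (possibly infinite) and a set \<open>E\<close>
  of two-element edges. The predicate \<open>tree\<close> of \<open>Graph_Theory\<close> is not suitable here: it only
  excludes directed cycles, so it admits directed acyclic graphs whose underlying undirected
  graph has cycles, while no symmetric digraph with an arc satisfies it.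
\<close>

definition simple_graph :: "'a set \<Rightarrow> 'a set set \<Rightarrow> bool" where
  "simple_graph V E \<longleftrightarrow> (\<forall>e\<in>E. \<exists>x\<in>V. \<exists>y\<in>V. x \<noteq> y \<and> e = {x, y})"

definition graph_path :: "'a set \<Rightarrow> 'a set set \<Rightarrow> 'a \<Rightarrow> 'a list \<Rightarrow> 'a \<Rightarrow> bool" where
  "graph_path V E x xs y \<longleftrightarrow>
     xs \<noteq> [] \<and> hd xs = x \<and> last xs = y \<and> set xs \<subseteq> V \<and> distinct xs \<and>
     successively (\<lambda>w z. {w, z} \<in> E) xs"

definition graph_cycle :: "'a set \<Rightarrow> 'a set set \<Rightarrow> 'a list \<Rightarrow> bool" where
  "graph_cycle V E xs \<longleftrightarrow>
     3 \<le> length xs \<and> set xs \<subseteq> V \<and> distinct xs \<and>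
     successively (\<lambda>w z. {w, z} \<in> E) xs \<and> {last xs, hd xs} \<in> E"

definition graph_connected :: "'a set \<Rightarrow> 'a set set \<Rightarrow> bool" where
  "graph_connected V E \<longleftrightarrow> (\<forall>x\<in>V. \<forall>y\<in>V. \<exists>xs. graph_path V E x xs y)"

text \<open>\<open>tree_le V E a s t\<close> is $s \preceq t$ in the tree with root \<open>a\<close>.\<close>

definition tree_le :: "'a set \<Rightarrow> 'a set set \<Rightarrow> 'a \<Rightarrow> 'a \<Rightarrow> 'a \<Rightarrow> bool" where
  "tree_le V E a s t \<longleftrightarrow> t \<in> V \<and> s \<in> set (THE xs. graph_path V E t xs a)"

definition tree_less :: "'a set \<Rightarrow> 'a set set \<Rightarrow> 'a \<Rightarrow> 'a \<Rightarrow> 'a \<Rightarrow> bool" where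
  "tree_less V E a s t \<longleftrightarrow> tree_le V E a s t \<and> s \<noteq> t"

definition tree_children :: "'a set \<Rightarrow> 'a set set \<Rightarrow> 'a \<Rightarrow> 'a \<Rightarrow> 'a set" where
  "tree_children V E a t = {s\<in>V. {s, t} \<in> E \<and> tree_less V E a t s}"

definition rooted_tree :: "'a set \<Rightarrow> 'a set set \<Rightarrow> 'a \<Rightarrow> bool" where
  "rooted_tree V E a \<longleftrightarrow>
     simple_graph V E \<and> graph_connected V E \<and> (\<nexists>xs. graph_cycle V E xs) \<and> a \<in> V \<and>
     (\<forall>t\<in>V. finite (tree_children V E a t))"

text \<open>The vertices $s$ with $a \prec s \preceq t$; in a rooted tree this set is finite.\<close>

definition tree_seg :: "'a set \<Rightarrow> 'a set set \<Rightarrow> 'a \<Rightarrow> 'a \<Rightarrow> 'a set" where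
  "tree_seg V E a t = {s. tree_less V E a a s \<and> tree_le V E a s t}"

text \<open>Powers on $[0,\infty]$ with $\infty^r = \infty$, to be used only for exponents $r > 0$.\<close>

definition ennreal_powr :: "ennreal \<Rightarrow> real \<Rightarrow> ennreal" where
  "ennreal_powr x r = (if x = \<infinity> then \<infinity> else ennreal (enn2real x powr r))"

definition A_tree ::
  "'a set \<Rightarrow> 'a set set \<Rightarrow> 'a \<Rightarrow> real \<Rightarrow> real \<Rightarrow> real \<Rightarrow> ('a \<Rightarrow> real) \<Rightarrow> ('a \<Rightarrow> real) \<Rightarrow> ennreal" where
  "A_tree V E a p q \<theta> u v =
     (SUP t\<in>V - {a}.
        ennreal ((\<Sum>s\<in>tree_seg V E a t. u s powr (- q)) powr (1 / (\<theta> * q))) *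
        ennreal_powr
          (\<Sum>\<^sub>\<infinity>s\<in>{s\<in>V - {a}. tree_le V E a t s}.
             ennreal (v s powr p *
               (\<Sum>r\<in>tree_seg V E a s. u r powr (- q)) powr (p / q * (1 - 1 / \<theta>))))
          (1 / p))"

text \<open>
  The weighted Hardy inequality with constant \<open>C\<close>. Real infinite sums have the value 0 when
  they diverge, so finiteness of the left-hand side is stated explicitly.
\<close>

definition hardy_inequality ::
  "'a set \<Rightarrow> 'a set set \<Rightarrow> 'a \<Rightarrow> real \<Rightarrow> ('a \<Rightarrow> real) \<Rightarrow> ('a \<Rightarrow> real) \<Rightarrow> real \<Rightarrow> bool" where
  "hardy_inequality V E a p u v C \<longleftrightarrow>
     (\<forall>d :: 'a \<Rightarrow> real.
        (\<lambda>s. \<bar>d s * u s\<bar> powr p) summable_on (V - {a}) \<longrightarrow>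
        (\<lambda>s. \<bar>v s * (\<Sum>t\<in>tree_seg V E a s. d t)\<bar> powr p) summable_on (V - {a}) \<and>
        (\<Sum>\<^sub>\<infinity>s\<in>V - {a}. \<bar>v s * (\<Sum>t\<in>tree_seg V E a s. d t)\<bar> powr p) powr (1 / p)
          \<le> C * (\<Sum>\<^sub>\<infinity>s\<in>V - {a}. \<bar>d s * u s\<bar> powr p) powr (1 / p))"

text \<open>
  The restriction to \<open>C \<ge> 0\<close> matters only for the one-vertex tree, where the inequality
  holds for every real \<open>C\<close>. Without an admissible constant the value is \<open>\<infinity>\<close>.
\<close>

definition hardy_optimal_const ::
  "'a set \<Rightarrow> 'a set set \<Rightarrow> 'a \<Rightarrow> real \<Rightarrow> ('a \<Rightarrow> real) \<Rightarrow> ('a \<Rightarrow> real) \<Rightarrow> ennreal" where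
  "hardy_optimal_const V E a p u v =
     (INF C\<in>{C. 0 \<le> C \<and> hardy_inequality V E a p u v C}. ennreal C)"

end

theory Submission
  imports Defs
begin

text \<open>
  Write $U_t = \sum_{a \prec r \preceq t} u_r^{-q}$. Hoelder's inequality applied to
  $d_t = (d_t u_t U_t^{1/(\theta q)}) \cdot (u_t^{-1} U_t^{-1/(\theta q)})$ along the path from the
  root to $s$, together with the telescoping bound
  $\sum_{a \prec t \preceq s} u_t^{-q} U_t^{-1/\theta} \le \frac{\theta}{\theta-1} U_s^{1-1/\theta}$,
  bounds $|\sum_{a \prec t \preceq s} d_t|^p$. After multiplication by $v_s^p$, summation over $s$ and
  an interchange of the sums, the coefficient of $|d_t u_t|^p$ is at most
  $(\theta/(\theta-1))^{p/q} A_{tree}^p$.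
\<close>

subsection \<open>Paths in acyclic graphs\<close>

lemma graph_path_suffix:
  assumes "graph_path V E x (xs @ z # zs) y"
  shows "graph_path V E z (z # zs) y"
  using assms by (auto simp: graph_path_def successively_append_iff)

text \<open>If two paths branch after \<open>x\<close>, they still share the endpoint
  \<open>y\<close>; following the first until it meets the second again closes a cycle through
  \<open>x\<close>. A common second vertex is left to the induction hypothesis.\<close>

lemma graph_path_unique:
  assumes acyclic: "\<nexists>xs. graph_cycle V E xs"
    and "graph_path V E x xs y" "graph_path V E x ys y"
  shows "xs = ys"
  using assms(2,3)
proof (induction xs arbitrary: x ys)
  case Nil
  then show ?case by (simp add: graph_path_def)
next
  case (Cons w xs)
  then have [simp]: "w = x" by (simp add: graph_path_def)
  from Cons.prems(2) obtain ys' where ys: "ys = x # ys'"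
    by (cases ys) (auto simp: graph_path_def)
  show ?case
  proof (cases "xs = [] \<or> ys' = []")
    case True
    then show ?thesis using Cons.prems ys
      by (auto simp: graph_path_def split: if_splits)
  next
    case False
    have px: "graph_path V E (hd xs) xs y" "graph_path V E (hd ys') ys' y"
      using Cons.prems ys False by (auto simp: graph_path_def successively_Cons)
    have ex: "{x, hd xs} \<in> E" "{x, hd ys'} \<in> E" "x \<in> V" "x \<notin> set xs" "x \<notin> set ys'"
      using Cons.prems ys False by (auto simp: graph_path_def successively_Cons)
    show ?thesis
    proof (cases "hd xs = hd ys'")
      case True
      then show ?thesis using Cons.IH px ys by simp
    next
      case neq: False
      \<comment> \<open>Both tails contain \<open>y\<close>, so they meet. Taking the first such
        vertex \<open>z\<close> along \<open>xs\<close> keeps \<open>as\<close> disjoint from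
        \<open>ys'\<close>, so the cycle built below repeats no vertex.\<close>
      have "\<exists>z\<in>set xs. z \<in> set ys'"
        using px False unfolding graph_path_def by (metis last_in_set)
      then obtain as z bs where xs: "xs = as @ z # bs" "z \<in> set ys'" "\<forall>w\<in>set as. w \<notin> set ys'"
        by (rule split_list_first_propE)
      from xs(2) obtain cs ds where ys': "ys' = cs @ z # ds"
        by (auto dest: split_list)
      \<comment> \<open>Traversing \<open>cs\<close> backwards swaps the arguments of the adjacency
        predicate, which is harmless because edges are unordered.\<close>
      have sym: "successively (\<lambda>x y. {y, x} \<in> E) cs = successively (\<lambda>x y. {x, y} \<in> E) cs"
        by (simp add: insert_commute)
      have "graph_cycle V E (x # as @ z # rev cs)"
        unfolding graph_cycle_def
      proof (intro conjI)
        \<comment> \<open>\<open>as\<close> and \<open>cs\<close> cannot both be empty: then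
          \<open>hd xs\<close> and \<open>hd ys'\<close> would both be \<open>z\<close>.\<close>
        show "3 \<le> length (x # as @ z # rev cs)"
          using neq xs ys' by (cases as; cases cs) auto
        show "set (x # as @ z # rev cs) \<subseteq> V"
          using px ex xs ys' by (auto simp: graph_path_def)
        show "distinct (x # as @ z # rev cs)"
          using px ex xs ys' by (auto simp: graph_path_def)
        show "successively (\<lambda>w z. {w, z} \<in> E) (x # as @ z # rev cs)"
          using px ex xs ys' sym
          by (auto simp: graph_path_def successively_append_iff successively_Cons hd_append hd_rev
                insert_commute)
        \<comment> \<open>The last vertex is \<open>hd ys'\<close>, also when \<open>cs\<close> is
          empty.\<close>
        show "{last (x # as @ z # rev cs), hd (x # as @ z # rev cs)} \<in> E"
          using ex ys' by (cases cs) (auto simp: insert_commute)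
      qed
      then show ?thesis using acyclic by blast
    qed
  qed
qed

text \<open>Path uniqueness evaluates the \<open>THE\<close> in \<open>tree_le\<close>, so the order
  can be read off any path at hand.\<close>

lemma tree_le_path_iff:
  assumes "\<nexists>xs. graph_cycle V E xs" "graph_path V E t xs a"
  shows "tree_le V E a s t \<longleftrightarrow> s \<in> set xs"
proof -
  have "(THE xs. graph_path V E t xs a) = xs"
    using graph_path_unique[OF assms(1)] assms(2) by blast
  moreover have "t \<in> V"
    using assms(2) by (auto simp: graph_path_def)
  ultimately show ?thesis by (simp add: tree_le_def)
qed

text \<open>Every suffix of the path is again a path to \<open>a\<close>, so all its vertices
  succeed the root and the condition \<open>tree_less V E a a s\<close> removes only
  \<open>a\<close>.\<close>

lemma tree_seg_path:
  assumes "\<nexists>xs. graph_cycle V E xs" "graph_path V E t xs a"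
  shows "tree_seg V E a t = set xs - {a}"
proof -
  have "tree_le V E a a s" if "s \<in> set xs" for s
  proof -
    from that obtain as bs where "xs = as @ s # bs" by (auto dest: split_list)
    then have p: "graph_path V E s (s # bs) a"
      using assms(2) graph_path_suffix by metis
    then have "a \<in> set (s # bs)" by (auto simp: graph_path_def split: if_splits)
    then show ?thesis using tree_le_path_iff[OF assms(1) p] by blast
  qed
  then show ?thesis
    using tree_le_path_iff[OF assms] by (auto simp: tree_seg_def tree_less_def)
qed

subsection \<open>Inequalities for sums along a path\<close>

text \<open>The concave function \<open>x powr (1 - \<beta>)\<close> lies below its tangent at
  \<open>s + U\<close>; evaluating at \<open>U\<close> and dividing by \<open>1 - \<beta>\<close>
  gives the claim. The tangent bound comes from Young's inequality with weights
  \<open>\<beta>\<close> and \<open>1 - \<beta>\<close>.\<close>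

lemma powr_telescope_step:
  fixes s U \<beta> :: real
  assumes "0 < s" "0 \<le> U" "0 < \<beta>" "\<beta> < 1"
  shows "s * (s + U) powr (- \<beta>) + U powr (1 - \<beta>) / (1 - \<beta>) \<le> (s + U) powr (1 - \<beta>) / (1 - \<beta>)"
proof -
  define x where "x = s + U"
  have x: "0 < x" using assms by (simp add: x_def)
  have *: "x powr (1 - \<beta>) = x * x powr (- \<beta>)"
    using x by (simp add: powr_diff powr_minus field_simps)
  have "U powr (1 - \<beta>) \<le> \<beta> * x powr (1 - \<beta>) + (1 - \<beta>) * U * x powr (- \<beta>)"
  \<comment> \<open>Young's inequality is applied to positive numbers; for \<open>U = 0\<close> the
    left side is \<open>0\<close>.\<close>
  proof (cases "U = 0")
    case False
    then have "x powr \<beta> * U powr (1 - \<beta>) \<le> \<beta> * x + (1 - \<beta>) * U"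
      using assms x by (intro Youngs_inequality_0) auto
    then have le: "x powr (- \<beta>) * (x powr \<beta> * U powr (1 - \<beta>))
        \<le> x powr (- \<beta>) * (\<beta> * x + (1 - \<beta>) * U)"
      by (intro mult_left_mono) auto
    have "x powr (- \<beta>) * (x powr \<beta> * U powr (1 - \<beta>)) = U powr (1 - \<beta>)"
      using x by (simp add: powr_minus flip: mult.assoc)
    with le show ?thesis unfolding * by (simp only: algebra_simps)
  qed (use assms in auto)
  moreover have s: "s = x - U" by (simp add: x_def)
  ultimately have "(1 - \<beta>) * (s * x powr (- \<beta>)) + U powr (1 - \<beta>) \<le> x powr (1 - \<beta>)"
    unfolding * s by (simp only: algebra_simps)
  then have "((1 - \<beta>) * (s * x powr (- \<beta>)) + U powr (1 - \<beta>)) / (1 - \<beta>)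
      \<le> x powr (1 - \<beta>) / (1 - \<beta>)"
    using assms(4) by (intro divide_right_mono) auto
  then show ?thesis
    using assms(4) by (simp add: x_def add_divide_distrib)
qed

text \<open>A discrete counterpart of integrating \<open>x powr (- \<beta>)\<close> from
  \<open>0\<close> to the total weight: each vertex contributes one increment, bounded by
  \<open>powr_telescope_step\<close>.\<close>

lemma tree_seg_telescope:
  fixes \<sigma> :: "'a \<Rightarrow> real"
  assumes acyclic: "\<nexists>xs. graph_cycle V E xs" and "graph_path V E t xs a"
    and "\<forall>s\<in>V - {a}. 0 < \<sigma> s" "0 < \<beta>" "\<beta> < 1"
  shows "(\<Sum>s\<in>tree_seg V E a t. \<sigma> s * (\<Sum>r\<in>tree_seg V E a s. \<sigma> r) powr (- \<beta>))
    \<le> (\<Sum>r\<in>tree_seg V E a t. \<sigma> r) powr (1 - \<beta>) / (1 - \<beta>)"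
  using assms(2)
proof (induction xs arbitrary: t)
  case Nil
  then show ?case by (simp add: graph_path_def)
next
  case (Cons x xs)
  then have [simp]: "x = t" by (simp add: graph_path_def)
  show ?case
  proof (cases "xs = []")
    case True
    then have "tree_seg V E a t = {}"
      using Cons.prems tree_seg_path[OF acyclic Cons.prems] by (auto simp: graph_path_def)
    then show ?thesis by simp
  next
    case False
    have path: "graph_path V E (hd xs) xs a"
      using Cons.prems False by (auto simp: graph_path_def successively_Cons)
    have "t \<in> V" "t \<notin> set xs" "t \<noteq> a"
      using Cons.prems False by (auto simp: graph_path_def)
    \<comment> \<open>\<open>hd xs\<close> is the parent of \<open>t\<close>, so passing to
      \<open>t\<close> adds just one vertex to the segment.\<close>
    have seg: "tree_seg V E a t = insert t (tree_seg V E a (hd xs))"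
      "finite (tree_seg V E a (hd xs))" "t \<notin> tree_seg V E a (hd xs)"
      "tree_seg V E a (hd xs) \<subseteq> V - {a}"
      using tree_seg_path[OF acyclic Cons.prems] tree_seg_path[OF acyclic path] path
        \<open>t \<notin> set xs\<close> \<open>t \<noteq> a\<close>
      by (auto simp: graph_path_def)
    define U where "U = (\<Sum>r\<in>tree_seg V E a (hd xs). \<sigma> r)"
    have "0 \<le> U"
      unfolding U_def using assms(3) seg(4) by (intro sum_nonneg) (auto intro: less_imp_le)
    have Ut: "(\<Sum>r\<in>tree_seg V E a t. \<sigma> r) = \<sigma> t + U"
      using seg by (simp add: U_def)
    have "(\<Sum>s\<in>tree_seg V E a t. \<sigma> s * (\<Sum>r\<in>tree_seg V E a s. \<sigma> r) powr (- \<beta>))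
      = \<sigma> t * (\<sigma> t + U) powr (- \<beta>)
        + (\<Sum>s\<in>tree_seg V E a (hd xs). \<sigma> s * (\<Sum>r\<in>tree_seg V E a s. \<sigma> r) powr (- \<beta>))"
      using sum.insert[OF seg(2,3), folded seg(1), of "\<lambda>s. \<sigma> s * (\<Sum>r\<in>tree_seg V E a s. \<sigma> r) powr (- \<beta>)"]
      by (simp only: Ut)
    also have "\<dots> \<le> \<sigma> t * (\<sigma> t + U) powr (- \<beta>) + U powr (1 - \<beta>) / (1 - \<beta>)"
      using Cons.IH[OF path] by (simp add: U_def)
    also have "\<dots> \<le> (\<sigma> t + U) powr (1 - \<beta>) / (1 - \<beta>)"
      using assms \<open>0 \<le> U\<close> \<open>t \<in> V\<close> \<open>t \<noteq> a\<close> by (intro powr_telescope_step) auto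
    finally show ?thesis by (simp only: Ut)
  qed
qed

text \<open>After division of \<open>f\<close> and \<open>g\<close> by their norms, Young's
  inequality applies termwise and its right-hand sides add up to
  \<open>1 / p + 1 / q\<close>.\<close>

lemma Holder_inequality_sum:
  fixes f g :: "'a \<Rightarrow> real"
  assumes "1 < p" "1 < q" "1 / p + 1 / q = 1" "finite S"
    and "\<And>i. i \<in> S \<Longrightarrow> 0 \<le> f i" "\<And>i. i \<in> S \<Longrightarrow> 0 \<le> g i"
  shows "(\<Sum>i\<in>S. f i * g i)
    \<le> (\<Sum>i\<in>S. f i powr p) powr (1 / p) * (\<Sum>i\<in>S. g i powr q) powr (1 / q)"
proof -
  define F G where "F = (\<Sum>i\<in>S. f i powr p)" and "G = (\<Sum>i\<in>S. g i powr q)"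
  show ?thesis
  \<comment> \<open>A zero norm cannot be divided by, but it makes every product vanish.\<close>
  proof (cases "F = 0 \<or> G = 0")
    case True
    then have "\<forall>i\<in>S. f i * g i = 0"
      unfolding F_def G_def using assms(4) by (auto simp: sum_nonneg_eq_0_iff)
    then show ?thesis by (simp add: sum.neutral)
  next
    case False
    moreover have "0 \<le> F" "0 \<le> G" by (auto simp: F_def G_def intro: sum_nonneg)
    ultimately have pos: "0 < F" "0 < G" by auto
    define c where "c = F powr (1 / p)"
    define e where "e = G powr (1 / q)"
    have ce: "0 < c" "0 < e" "c powr p = F" "e powr q = G"
      using pos assms(1,2) by (auto simp: c_def e_def powr_powr)
    have "(\<Sum>i\<in>S. f i / c * (g i / e)) \<le> (\<Sum>i\<in>S. f i powr p / F / p + g i powr q / G / q)"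
      using assms ce
      by (intro sum_mono order.trans[OF Youngs_inequality[OF assms(1,2,3)]])
        (auto simp: powr_divide)
    also have "\<dots> = (\<Sum>i\<in>S. f i powr p) / F / p + (\<Sum>i\<in>S. g i powr q) / G / q"
      by (simp add: sum.distrib sum_divide_distrib)
    also have "\<dots> = 1"
      using pos assms(3) by (simp flip: F_def G_def)
    finally have "(\<Sum>i\<in>S. f i * g i) / (c * e) \<le> 1"
      by (simp add: sum_divide_distrib)
    then show ?thesis
      using ce(1,2) by (simp add: c_def e_def F_def G_def field_simps)
  qed
qed

text \<open>The bound is shaped for \<open>A_tree\<close>: the power of \<open>U s\<close> joins
  \<open>v s powr p\<close> in the inner summand, and the power of \<open>U t\<close> is the
  \<open>p\<close>-th power of the first factor.\<close>

lemma tree_seg_Holder: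
  fixes u d :: "'a \<Rightarrow> real"
  assumes pq: "1 < p" "1 < q" "1 / p + 1 / q = 1" and "1 < \<theta>"
    and acyclic: "\<nexists>xs. graph_cycle V E xs" and path: "graph_path V E s xs a"
    and u: "\<forall>t\<in>V - {a}. 0 < u t"
  defines "U \<equiv> \<lambda>t. \<Sum>r\<in>tree_seg V E a t. u r powr (- q)"
  shows "\<bar>\<Sum>t\<in>tree_seg V E a s. d t\<bar> powr p
    \<le> (\<theta> / (\<theta> - 1)) powr (p / q) * U s powr (p / q * (1 - 1 / \<theta>))
      * (\<Sum>t\<in>tree_seg V E a s. \<bar>d t * u t\<bar> powr p * U t powr (p / (\<theta> * q)))"
proof -
  let ?S = "tree_seg V E a s"
  have seg: "?S = set xs - {a}" by (rule tree_seg_path[OF acyclic path])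
  have S: "finite ?S" "?S \<subseteq> V - {a}"
    using path unfolding seg by (auto simp: graph_path_def)
  \<comment> \<open>\<open>t\<close> lies in its own segment, so the sum \<open>U t\<close> has a
    positive term.\<close>
  have Upos: "0 < U t" if "t \<in> ?S" for t
  proof -
    from that obtain as bs where "xs = as @ t # bs" by (auto simp: seg dest: split_list)
    then have p: "graph_path V E t (t # bs) a"
      using path graph_path_suffix by metis
    have "tree_seg V E a t = set (t # bs) - {a}" by (rule tree_seg_path[OF acyclic p])
    then have "finite (tree_seg V E a t)" "t \<in> tree_seg V E a t" "tree_seg V E a t \<subseteq> V - {a}"
      using that p by (auto simp: seg graph_path_def)
    then show ?thesis
      unfolding U_def using u by (intro sum_pos) force+
  qed
  \<comment> \<open>With this exponent \<open>\<gamma> * q = 1 / \<theta>\<close>, so the sum of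
    \<open>g t powr q\<close> telescopes with \<open>\<beta> = 1 / \<theta>\<close>.\<close>
  define \<gamma> where "\<gamma> = 1 / (\<theta> * q)"
  define f where "f t = \<bar>d t * u t\<bar> * U t powr \<gamma>" for t
  define g where "g t = U t powr (- \<gamma>) / u t" for t
  have upos: "0 < u t" if "t \<in> ?S" for t
    using that S u by auto
  have fg: "\<bar>d t\<bar> = f t * g t" if "t \<in> ?S" for t
    using Upos[OF that] upos[OF that] by (simp add: f_def g_def abs_mult powr_minus field_simps)
  have fp: "f t powr p = \<bar>d t * u t\<bar> powr p * U t powr (p / (\<theta> * q))" if "t \<in> ?S" for t
    by (simp add: f_def powr_mult powr_powr \<gamma>_def)
  have gq: "g t powr q = u t powr (- q) * U t powr (- (1 / \<theta>))" if "t \<in> ?S" for t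
  proof -
    have "\<gamma> * q = 1 / \<theta>" using pq by (simp add: \<gamma>_def)
    then show ?thesis by (simp add: g_def powr_divide powr_mult powr_powr powr_minus inverse_powr divide_inverse)
  qed
  have "(\<Sum>t\<in>?S. g t powr q) = (\<Sum>t\<in>?S. u t powr (- q) * U t powr (- (1 / \<theta>)))"
    using gq by (intro sum.cong) auto
  also have "\<dots> \<le> U s powr (1 - 1 / \<theta>) / (1 - 1 / \<theta>)"
    unfolding U_def using u \<open>1 < \<theta>\<close>
    by (intro tree_seg_telescope[OF acyclic path]) (auto dest!: bspec)
  \<comment> \<open>The telescoping factor \<open>1 / (1 - 1 / \<theta>)\<close> is the source of
    the constant.\<close>
  also have "\<dots> = \<theta> / (\<theta> - 1) * U s powr (1 - 1 / \<theta>)"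
    using \<open>1 < \<theta>\<close> by (simp add: field_simps)
  finally have G: "(\<Sum>t\<in>?S. g t powr q) \<le> \<theta> / (\<theta> - 1) * U s powr (1 - 1 / \<theta>)" .
  have "\<bar>\<Sum>t\<in>?S. d t\<bar> \<le> (\<Sum>t\<in>?S. f t * g t)"
    using fg by (intro order.trans[OF sum_abs]) simp
  also have "\<dots> \<le> (\<Sum>t\<in>?S. f t powr p) powr (1 / p) * (\<Sum>t\<in>?S. g t powr q) powr (1 / q)"
    using upos by (intro Holder_inequality_sum pq S) (auto simp: f_def g_def less_imp_le)
  finally have "\<bar>\<Sum>t\<in>?S. d t\<bar> powr p
    \<le> ((\<Sum>t\<in>?S. f t powr p) powr (1 / p) * (\<Sum>t\<in>?S. g t powr q) powr (1 / q)) powr p"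
    using pq by (intro powr_mono2) auto
  also have "\<dots> = (\<Sum>t\<in>?S. f t powr p) * (\<Sum>t\<in>?S. g t powr q) powr (p / q)"
    using pq by (simp add: powr_mult powr_powr sum_nonneg)
  also have "\<dots> \<le> (\<Sum>t\<in>?S. f t powr p) * (\<theta> / (\<theta> - 1) * U s powr (1 - 1 / \<theta>)) powr (p / q)"
    using pq by (intro mult_left_mono powr_mono2 G sum_nonneg) auto
  also have "\<dots> = (\<theta> / (\<theta> - 1)) powr (p / q) * U s powr (p / q * (1 - 1 / \<theta>))
      * (\<Sum>t\<in>?S. \<bar>d t * u t\<bar> powr p * U t powr (p / (\<theta> * q)))"
  proof -
    have "(\<theta> / (\<theta> - 1) * U s powr (1 - 1 / \<theta>)) powr (p / q)
        = (\<theta> / (\<theta> - 1)) powr (p / q) * U s powr (p / q * (1 - 1 / \<theta>))"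
      unfolding powr_mult powr_powr by (simp only: mult.commute)
    then show ?thesis using fp by (simp only: mult_ac cong: sum.cong)
  qed
  finally show ?thesis .
qed

subsection \<open>The Hardy inequality\<close>

lemma ennreal_powr_mono:
  assumes "x \<le> y" "0 < r"
  shows "ennreal_powr x r \<le> ennreal_powr y r"
  using assms
  by (auto simp: ennreal_powr_def top_unique less_top intro!: ennreal_leI powr_mono2 enn2real_mono)

text \<open>One term of the supremum is raised to the power \<open>p\<close> and its inner sum cut
  down to \<open>F\<close>; this turns the extended-real bound into a real one usable inside finite
  sums.\<close>

lemma A_tree_finite_sum_le:
  fixes u v :: "'a \<Rightarrow> real"
  assumes "0 < p" "A_tree V E a p q \<theta> u v \<le> ennreal A" "0 \<le> A"
    and "t \<in> V - {a}" "finite F" "F \<subseteq> {s\<in>V - {a}. tree_le V E a t s}"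
  shows "(\<Sum>s\<in>tree_seg V E a t. u s powr (- q)) powr (p / (\<theta> * q)) *
      (\<Sum>s\<in>F. v s powr p * (\<Sum>r\<in>tree_seg V E a s. u r powr (- q)) powr (p / q * (1 - 1 / \<theta>)))
    \<le> A powr p"
proof -
  define U where "U t = (\<Sum>r\<in>tree_seg V E a t. u r powr (- q))" for t
  define w where "w s = v s powr p * U s powr (p / q * (1 - 1 / \<theta>))" for s
  have w: "0 \<le> w s" for s by (simp add: w_def)
  have "ennreal (sum w F) = (\<Sum>s\<in>F. ennreal (w s))"
    using w by simp
  \<comment> \<open>In \<open>ennreal\<close> the infinite sum is the supremum of its finite partial
    sums.\<close>
  also have "\<dots> \<le> (\<Sum>\<^sub>\<infinity>s\<in>{s\<in>V - {a}. tree_le V E a t s}. ennreal (w s))"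
    using assms(5,6) by (subst nonneg_infsum_complete) (auto intro!: SUP_upper)
  finally have "ennreal_powr (ennreal (sum w F)) (1 / p)
      \<le> ennreal_powr (\<Sum>\<^sub>\<infinity>s\<in>{s\<in>V - {a}. tree_le V E a t s}. ennreal (w s)) (1 / p)"
    using assms(1) by (intro ennreal_powr_mono) auto
  moreover have "ennreal (U t powr (1 / (\<theta> * q))) *
      ennreal_powr (\<Sum>\<^sub>\<infinity>s\<in>{s\<in>V - {a}. tree_le V E a t s}. ennreal (w s)) (1 / p)
      \<le> A_tree V E a p q \<theta> u v"
    unfolding A_tree_def U_def w_def by (rule SUP_upper[OF assms(4)])
  ultimately have "ennreal (U t powr (1 / (\<theta> * q))) * ennreal_powr (ennreal (sum w F)) (1 / p)
      \<le> ennreal A"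
    using assms(2) by (meson mult_left_mono order.trans zero_le)
  moreover have "ennreal_powr (ennreal (sum w F)) (1 / p) = ennreal (sum w F powr (1 / p))"
    using w by (simp add: ennreal_powr_def sum_nonneg)
  ultimately have "U t powr (1 / (\<theta> * q)) * sum w F powr (1 / p) \<le> A"
    using assms(3) by (simp flip: ennreal_mult)
  then have "(U t powr (1 / (\<theta> * q)) * sum w F powr (1 / p)) powr p \<le> A powr p"
    using assms(1) by (intro powr_mono2) auto
  moreover have "(U t powr (1 / (\<theta> * q)) * sum w F powr (1 / p)) powr p
      = U t powr (p / (\<theta> * q)) * sum w F"
    using w assms(1) by (simp add: powr_mult powr_powr sum_nonneg)
  ultimately show ?thesis by (simp add: U_def w_def)
qed

text \<open>Only finite partial sums over \<open>F\<close> are estimated, so the interchange of sums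
  is finite; a bound uniform in \<open>F\<close> then yields both convergence and the estimate of
  the left-hand side.\<close>

lemma hardy_inequality_A_tree:
  fixes u v :: "'a \<Rightarrow> real"
  assumes pq: "1 < p" "1 < q" "1 / p + 1 / q = 1" and tree: "rooted_tree V E a"
    and u: "\<forall>t\<in>V - {a}. 0 < u t" and v: "\<forall>t\<in>V - {a}. 0 < v t" and "1 < \<theta>"
    and A: "A_tree V E a p q \<theta> u v \<le> ennreal A" "0 \<le> A"
  shows "hardy_inequality V E a p u v ((\<theta> / (\<theta> - 1)) powr (1 / q) * A)"
  unfolding hardy_inequality_def
proof (intro allI impI)
  fix d :: "'a \<Rightarrow> real"
  let ?V = "V - {a}" and ?seg = "tree_seg V E a"
  let ?K = "(\<theta> / (\<theta> - 1)) powr (p / q)"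
  let ?h = "\<lambda>s. \<bar>v s * (\<Sum>t\<in>?seg s. d t)\<bar> powr p"
  let ?e = "\<lambda>s. \<bar>d s * u s\<bar> powr p"
  assume summable: "?e summable_on ?V"
  define U where "U t = (\<Sum>r\<in>?seg t. u r powr (- q))" for t
  define w where "w s = v s powr p * U s powr (p / q * (1 - 1 / \<theta>))" for s
  define D where "D = infsum ?e ?V"
  have ex_path: "\<exists>xs. graph_path V E s xs a" if "s \<in> V" for s
    using tree that by (auto simp: rooted_tree_def graph_connected_def)
  have acyclic: "\<nexists>xs. graph_cycle V E xs"
    using tree by (auto simp: rooted_tree_def)
  have seg: "finite (?seg s)" "?seg s \<subseteq> ?V" if s: "s \<in> V" for s
  proof -
    obtain xs where p: "graph_path V E s xs a" using ex_path[OF s] by blast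
    then show "finite (?seg s)" "?seg s \<subseteq> ?V"
      unfolding tree_seg_path[OF acyclic p] by (auto simp: graph_path_def)
  qed
  have bound: "sum ?h F \<le> ?K * A powr p * D" if F: "finite F" "F \<subseteq> ?V" for F
  proof -
    \<comment> \<open>\<open>G\<close> collects every vertex of the inner sums, so the double sum
      runs over pairs from two finite sets related by \<open>t \<in> ?seg s\<close>, as
      \<open>sum.swap_restrict\<close> requires.\<close>
    define G where "G = (\<Union>s\<in>F. ?seg s)"
    have G: "finite G" "G \<subseteq> ?V"
      using F seg unfolding G_def by blast+
    have h: "?h s \<le> ?K * (\<Sum>t\<in>{t\<in>G. t \<in> ?seg s}. ?e t * U t powr (p / (\<theta> * q)) * w s)"
      if s: "s \<in> F" for s
    proof -
      obtain xs where p: "graph_path V E s xs a" using ex_path[of s] s F by blast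
      have Gs: "{t\<in>G. t \<in> ?seg s} = ?seg s" using s by (auto simp: G_def)
      have "0 < v s" using v s F by auto
      then have "?h s = v s powr p * \<bar>\<Sum>t\<in>?seg s. d t\<bar> powr p"
        by (simp add: abs_mult powr_mult)
      also have "\<dots> \<le> v s powr p * (?K * U s powr (p / q * (1 - 1 / \<theta>))
        * (\<Sum>t\<in>?seg s. ?e t * U t powr (p / (\<theta> * q))))"
        unfolding U_def
        by (intro mult_left_mono tree_seg_Holder[OF pq \<open>1 < \<theta>\<close> acyclic p u]) auto
      finally show ?thesis
        unfolding Gs by (simp add: w_def sum_distrib_left mult_ac)
    qed
    have "sum ?h F \<le> (\<Sum>s\<in>F. ?K * (\<Sum>t\<in>{t\<in>G. t \<in> ?seg s}. ?e t * U t powr (p / (\<theta> * q)) * w s))"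
      by (intro sum_mono h)
    also have "\<dots> = ?K * (\<Sum>t\<in>G. \<Sum>s\<in>{s\<in>F. t \<in> ?seg s}. ?e t * U t powr (p / (\<theta> * q)) * w s)"
      using F G by (simp add: sum.swap_restrict flip: sum_distrib_left)
    also have "\<dots> = ?K * (\<Sum>t\<in>G. ?e t * (U t powr (p / (\<theta> * q)) * sum w {s\<in>F. t \<in> ?seg s}))"
      by (simp add: sum_distrib_left mult_ac)
    also have "\<dots> \<le> ?K * (\<Sum>t\<in>G. ?e t * A powr p)"
    proof (intro mult_left_mono sum_mono)
      \<comment> \<open>Since \<open>t \<in> ?seg s\<close> includes
        \<open>tree_le V E a t s\<close>, the index set is a finite part of the subtree over which
        \<open>A_tree\<close> sums at \<open>t\<close>.\<close>
      fix t assume "t \<in> G"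
      then show "U t powr (p / (\<theta> * q)) * sum w {s\<in>F. t \<in> ?seg s} \<le> A powr p"
        unfolding U_def w_def using pq A F G
        by (intro A_tree_finite_sum_le) (auto simp: tree_seg_def)
    qed auto
    also have "\<dots> = ?K * A powr p * sum ?e G"
      by (simp add: mult_ac flip: sum_distrib_left)
    also have "\<dots> \<le> ?K * A powr p * D"
      unfolding D_def using G summable
      by (intro mult_left_mono finite_sum_le_infsum) auto
    finally show ?thesis .
  qed
  have h: "?h summable_on ?V"
    by (rule nonneg_bdd_above_summable_on) (auto intro!: bdd_aboveI2 bound)
  have "infsum ?h ?V \<le> ?K * A powr p * D"
    using h bound by (rule infsum_le_finite_sums)
  then have "infsum ?h ?V powr (1 / p) \<le> (?K * A powr p * D) powr (1 / p)"
    using pq by (intro powr_mono2 infsum_nonneg) auto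
  \<comment> \<open>The root turns the exponent \<open>p / q\<close> of the constant into
    \<open>1 / q\<close>.\<close>
  also have "\<dots> = (\<theta> / (\<theta> - 1)) powr (1 / q) * A * D powr (1 / p)"
    using pq A by (simp add: powr_mult powr_powr D_def infsum_nonneg)
  finally show "?h summable_on ?V \<and>
      infsum ?h ?V powr (1 / p) \<le> (\<theta> / (\<theta> - 1)) powr (1 / q) * A * infsum ?e ?V powr (1 / p)"
    using h by (simp add: D_def)
qed

theorem theorem2p3:
  fixes V :: "'a set" and E :: "'a set set" and a :: 'a
    and u v :: "'a \<Rightarrow> real" and p q \<theta> :: real
  assumes "1 < p" and "1 < q" and "1 / p + 1 / q = 1"
    and "rooted_tree V E a"
    and "\<forall>t\<in>V - {a}. 0 < u t" and "\<forall>t\<in>V - {a}. 0 < v t"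
    and "1 < \<theta>"
    and "A_tree V E a p q \<theta> u v < \<infinity>"
  shows "(\<exists>C. hardy_inequality V E a p u v C) \<and>
         hardy_optimal_const V E a p u v
           \<le> ennreal ((\<theta> / (\<theta> - 1)) powr (1 / q)) * A_tree V E a p q \<theta> u v"
proof -
  obtain A where A: "A_tree V E a p q \<theta> u v = ennreal A" "0 \<le> A"
    using assms(8) by (cases "A_tree V E a p q \<theta> u v") auto
  let ?C = "(\<theta> / (\<theta> - 1)) powr (1 / q) * A"
  have C: "hardy_inequality V E a p u v ?C"
    using assms A by (intro hardy_inequality_A_tree) auto
  \<comment> \<open>\<open>?C\<close> is nonnegative, hence admissible in the infimum.\<close>
  have "hardy_optimal_const V E a p u v \<le> ennreal ?C"
    unfolding hardy_optimal_const_def using C A(2) by (intro INF_lower) auto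
  then show ?thesis
    using C A by (auto simp: ennreal_mult)
qed

end
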